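(* Let $P(\lambda)=\lambda^2A+\lambda Q+\epsilon A^{H}$ be an $(H,\epsilon)$-palindromic quadratic matrix polynomial with $A,Q\in\mathbb{C}^{n\times n}$, $A$ nonsingular, $Q^H=\epsilon Q$, and let $(X,J)$ be a standard pair of $P(\lambda)$ with $X=[X_1,\dots,X_r]$, $J=\mathrm{diag}(J_1,\dots,J_r)$ in the Jordan canonical form described in the context. Then there is a matrix $\Gamma\in\mathcal{S}_{(J,H,\epsilon)}\subset\mathbb{C}^{2n\times2n}$ such that $$A=(XJ\Gamma X^{H})^{-1},\qquad Q=-AXJ^2\Gamma X^{H}A,$$ with $Q^H=\epsilon Q$, and $\Gamma$ has the form $$\Gamma=\mathrm{diag}\left(\begin{bmatrix}0&S_1\\-\epsilon S_1^H&0\end{bmatrix},\dots,\begin{bmatrix}0&S_l\\-\epsilon S_l^H&0\end{bmatrix},S_{l+1},\dots,S_r\right),$$ where $S_j\in\Theta_{(\lambda_j,1/\lambda_j,j)}$ for $j=1,\dots,l$, and $S_j\in\Theta_{(\lambda_j,\bar\lambda_j,j)}$ with $S_j^H=-\epsilon S_j$ for $j=l+1,\dots,r$.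
   Context: $\epsilon\in\{1,-1\}$; $H$ is conjugate transpose; $B^{-H}=(B^{-1})^H$. Standard pair: $(X,J)\in\mathbb{C}^{n\times 2n}\times\mathbb{C}^{2n\times 2n}$ is a standard pair of $P(\lambda)=\lambda^2A+\lambda Q+\epsilon A^H$ if $\begin{bmatrix}X\\ XJ\end{bmatrix}$ is nonsingular and $AXJ^2+QXJ+\epsilon A^HX=0$. For nonsingular $B\in\mathbb{C}^{m\times m}$, $\mathcal{S}_{(B,H,\epsilon)}=\{S\in\mathbb{C}^{m\times m}:S^H=-\epsilon S,\ BS=SB^{-H}\}$. $N_j$ denotes an $n_j\times n_j$ nilpotent matrix with ones or zeros along its superdiagonal and zeros elsewhere. For nonzero $a,b\in\mathbb{C}$, $\Theta_{(a,b,j)}=\{Z\in\mathbb{C}^{n_j\times n_j}: aZN_j^T+bN_jZ+N_jZN_j^T=0\}$. Form of $J$: $J=\mathrm{diag}(J_1,\dots,J_r)\in\mathbb{C}^{2n\times 2n}$, where different $J_j$ have no common eigenvalue and - for $j=1,\dots,l$: $J_j=\mathrm{diag}(\lambda_jI_{n_j}+N_j,\ \tfrac1{\bar\lambda_j}I_{n_j}+N_j)$, $\lambda_j\in\mathbb{C}$ nonzero, $|\lambda_j|\ne1$; - for $j=l+1,\dots,r$: $J_j=\lambda_jI_{n_j}+N_j$, $|\lambda_j|=1$, with $2(n_1+\cdots+n_l)+n_{l+1}+\cdots+n_r=2n$. $X=[X_1,\dots,X_r]\in\mathbb{C}^{n\times 2n}$ is partitioned conformably; the columns of $X_j$ are the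 generalized eigenvectors belonging to $J_j$. *)

theory Defs
  imports
    "Jordan_Normal_Form.Schur_Decomposition"
    "Jordan_Normal_Form.Gauss_Jordan_Elimination"
begin

text \<open>
  Matrices have type \<^typ>\<open>complex mat\<close>, and their sizes are given by \<^const>\<open>carrier_mat\<close>.
  The superscript \<open>H\<close> is \<^const>\<open>mat_adjoint\<close>, and \<open>A = B\<^sup>-\<^sup>1\<close> is \<open>mat_inverse B = Some A\<close>,
  which includes that \<open>B\<close> is nonsingular.
  The matrix polynomial \<open>z\<^sup>2 A + z Q + eps A\<^sup>H\<close> is given by \<open>eps\<close>, \<open>A\<close> and \<open>Q\<close>.
\<close>

definition standard_pair ::
  "nat \<Rightarrow> complex \<Rightarrow> complex mat \<Rightarrow> complex mat \<Rightarrow> complex mat \<Rightarrow> complex mat \<Rightarrow> bool" where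
  "standard_pair n eps A Q X J \<longleftrightarrow>
     X \<in> carrier_mat n (2 * n) \<and> J \<in> carrier_mat (2 * n) (2 * n) \<and>
     invertible_mat (X @\<^sub>r (X * J)) \<and>
     A * X * (J ^\<^sub>m 2) + Q * X * J + eps \<cdot>\<^sub>m (mat_adjoint A * X) = 0\<^sub>m n (2 * n)"

definition S_set :: "nat \<Rightarrow> complex mat \<Rightarrow> complex \<Rightarrow> complex mat set" where
  "S_set m B eps =
     {S \<in> carrier_mat m m. mat_adjoint S = (- eps) \<cdot>\<^sub>m S \<and>
        (\<exists>C. mat_inverse B = Some C \<and> B * S = S * mat_adjoint C)}"

definition superdiag_nilpotent :: "nat \<Rightarrow> complex mat \<Rightarrow> bool" where
  "superdiag_nilpotent m N \<longleftrightarrow> N \<in> carrier_mat m m \<and>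
     (\<forall>i<m. \<forall>k<m. if k = Suc i then N $$ (i, k) \<in> {0, 1} else N $$ (i, k) = 0)"

text \<open>\<open>\<Theta>\<^sub>(\<^sub>a\<^sub>,\<^sub>b\<^sub>,\<^sub>j\<^sub>)\<close> is \<open>Theta (ns j) (N j) a b\<close>; it is only used for nonzero \<open>a\<close> and \<open>b\<close>.\<close>

definition Theta :: "nat \<Rightarrow> complex mat \<Rightarrow> complex \<Rightarrow> complex \<Rightarrow> complex mat set" where
  "Theta m N a b =
     {Z \<in> carrier_mat m m.
        a \<cdot>\<^sub>m (Z * transpose_mat N) + b \<cdot>\<^sub>m (N * Z) + N * Z * transpose_mat N = 0\<^sub>m m m}"

text \<open>The block \<open>J\<^sub>j\<close>; block indices start at 1, and the first \<open>l\<close> blocks are the paired ones.\<close>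

definition J_block ::
  "nat \<Rightarrow> (nat \<Rightarrow> nat) \<Rightarrow> (nat \<Rightarrow> complex) \<Rightarrow> (nat \<Rightarrow> complex mat) \<Rightarrow> nat \<Rightarrow> complex mat" where
  "J_block l ns lam N j =
     (if j \<le> l
      then diag_block_mat [lam j \<cdot>\<^sub>m 1\<^sub>m (ns j) + N j, (1 / cnj (lam j)) \<cdot>\<^sub>m 1\<^sub>m (ns j) + N j]
      else lam j \<cdot>\<^sub>m 1\<^sub>m (ns j) + N j)"

definition jordan_form ::
  "nat \<Rightarrow> nat \<Rightarrow> nat \<Rightarrow> (nat \<Rightarrow> nat) \<Rightarrow> (nat \<Rightarrow> complex) \<Rightarrow> (nat \<Rightarrow> complex mat) \<Rightarrow> complex mat \<Rightarrow> bool"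
where
  "jordan_form n l r ns lam N J \<longleftrightarrow>
     l \<le> r \<and>
     (\<forall>j\<in>{1..r}. 0 < ns j \<and> superdiag_nilpotent (ns j) (N j)) \<and>
     (\<forall>j\<in>{1..l}. lam j \<noteq> 0 \<and> cmod (lam j) \<noteq> 1) \<and>
     (\<forall>j\<in>{l+1..r}. cmod (lam j) = 1) \<and>
     2 * (\<Sum>j=1..l. ns j) + (\<Sum>j=l+1..r. ns j) = 2 * n \<and>
     (\<forall>i\<in>{1..r}. \<forall>j\<in>{1..r}. i \<noteq> j \<longrightarrow>
        \<not> (\<exists>k. eigenvalue (J_block l ns lam N i) k \<and> eigenvalue (J_block l ns lam N j) k)) \<and>
     J = diag_block_mat (map (J_block l ns lam N) [1..<Suc r])"

text \<open>
  \<open>X = [X\<^sub>1, \<dots>, X\<^sub>r]\<close>, partitioned conformably with \<open>J\<close>. For a standard pair the columns of \<open>X\<^sub>j\<close>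
  are then generalized eigenvectors belonging to \<open>J\<^sub>j\<close>: the defining equation of a standard pair,
  restricted to the columns of block \<open>j\<close>, reads
  \<open>A X\<^sub>j J\<^sub>j\<^sup>2 + Q X\<^sub>j J\<^sub>j + eps A\<^sup>H X\<^sub>j = 0\<close>.
\<close>

definition conformable_partition ::
  "nat \<Rightarrow> nat \<Rightarrow> nat \<Rightarrow> (nat \<Rightarrow> nat) \<Rightarrow> (nat \<Rightarrow> complex mat) \<Rightarrow> complex mat \<Rightarrow> bool" where
  "conformable_partition n l r ns Xs X \<longleftrightarrow>
     (\<forall>j\<in>{1..r}. Xs j \<in> carrier_mat n (if j \<le> l then 2 * ns j else ns j)) \<and>
     X = mat_of_cols n (concat (map (\<lambda>j. cols (Xs j)) [1..<Suc r]))"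

definition Gamma_block ::
  "nat \<Rightarrow> (nat \<Rightarrow> nat) \<Rightarrow> complex \<Rightarrow> (nat \<Rightarrow> complex mat) \<Rightarrow> nat \<Rightarrow> complex mat" where
  "Gamma_block l ns eps S j =
     (if j \<le> l
      then four_block_mat (0\<^sub>m (ns j) (ns j)) (S j)
             ((- eps) \<cdot>\<^sub>m mat_adjoint (S j)) (0\<^sub>m (ns j) (ns j))
      else S j)"

end

theory Submission
  imports Defs
begin

text \<open>
  Stack \<open>X\<close> and \<open>X J\<close> to the nonsingular matrix \<open>U\<close>. The conclusion leaves no choice for
  \<open>U \<Gamma> U\<^sup>H\<close>: its lower left block \<open>X J \<Gamma> X\<^sup>H\<close> has to be \<open>A\<^sup>-\<^sup>1\<close>, and \<open>\<Gamma>\<^sup>H = -eps \<Gamma>\<close> gives the upper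
  right one; the formula for \<open>Q\<close> forces \<open>X \<Gamma> X\<^sup>H = 0\<close>, and \<open>J \<Gamma> = \<Gamma> J\<^sup>-\<^sup>H\<close>, that is
  \<open>J \<Gamma> J\<^sup>H = \<Gamma>\<close>, makes the lower right block equal to the upper left one. So \<open>\<Gamma>\<close> is defined by
  \<open>U \<Gamma> U\<^sup>H = W\<close> with the block matrix \<open>W = [0, -eps A\<^sup>-\<^sup>H; A\<^sup>-\<^sup>1, 0]\<close>.

  The equation \<open>A X J\<^sup>2 + Q X J + eps A\<^sup>H X = 0\<close> turns the blocks of \<open>W\<close> into those of
  \<open>(U J) \<Gamma> (U J)\<^sup>H\<close>. The palindromic structure \<open>Q\<^sup>H = eps Q\<close> makes its last block vanish, so
  the result is \<open>W\<close> again and \<open>J \<Gamma> J\<^sup>H = \<Gamma>\<close>. The formulas for \<open>A\<close> and \<open>Q\<close> can be read off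
  the same blocks. This is the content of \<open>standard_pair_Gamma\<close>.

  The block structure of \<open>\<Gamma>\<close> follows from \<open>J \<Gamma> J\<^sup>H = \<Gamma>\<close> and the spectrum of \<open>J\<close>. If \<open>B\<close> and
  \<open>D\<close> are upper triangular and \<open>a cnj b \<noteq> 1\<close> for all eigenvalues \<open>a\<close> of \<open>B\<close> and \<open>b\<close> of \<open>D\<close>, then
  \<open>B Z D\<^sup>H = Z\<close> forces \<open>Z = 0\<close> (\<open>stein_upper_triangular_trivial\<close>). The spectrum of every block
  \<open>J\<^sub>j\<close> is closed under \<open>z \<mapsto> 1 / cnj z\<close>, so that \<open>a cnj b = 1\<close> would give two different blocks a common
  eigenvalue; therefore \<open>\<Gamma>\<close> is block diagonal. Inside a paired block the same criterion kills the two
  diagonal blocks, because \<open>\<bar>\<lambda>\<^sub>j\<bar> \<noteq> 1\<close>, and skewness relates the other two.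
  What is left satisfies \<open>(a I + N) S (b I + N)\<^sup>H = S\<close> with \<open>a cnj b = 1\<close>, which expands to the equation that defines \<open>\<Theta>\<close> (\<open>Theta_of_stein\<close>).
\<close>

section \<open>Adjoints and block matrices\<close>

lemma mat_adjoint_altdef: "mat_adjoint A = map_mat cnj (transpose_mat A)" for A :: "complex mat"
  by (rule eq_matI) (auto simp: mat_adjoint_def mat_of_rows_def)

lemma index_mat_adjoint [simp]:
  fixes A :: "complex mat"
  shows "i < dim_col A \<Longrightarrow> j < dim_row A \<Longrightarrow> mat_adjoint A $$ (i, j) = cnj (A $$ (j, i))"
    and "dim_row (mat_adjoint A) = dim_col A" and "dim_col (mat_adjoint A) = dim_row A"
  by (auto simp: mat_adjoint_altdef)

lemma mat_adjoint_carrier [simp, intro]: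
  "A \<in> carrier_mat n m \<Longrightarrow> mat_adjoint A \<in> carrier_mat m n" for A :: "complex mat"
  by (auto simp: mat_adjoint_altdef)

lemma mat_adjoint_adjoint [simp]: "mat_adjoint (mat_adjoint A) = A" for A :: "complex mat"
  by (rule eq_matI) auto

lemma mat_adjoint_one [simp]: "mat_adjoint (1\<^sub>m n :: complex mat) = 1\<^sub>m n"
  by (rule eq_matI) auto

lemma mat_adjoint_zero [simp]: "mat_adjoint (0\<^sub>m n m :: complex mat) = 0\<^sub>m m n"
  by (rule eq_matI) auto

lemma mat_adjoint_smult: "mat_adjoint (c \<cdot>\<^sub>m A) = cnj c \<cdot>\<^sub>m mat_adjoint A" for A :: "complex mat"
  by (rule eq_matI) auto

lemma smult_smult_mat: "a \<cdot>\<^sub>m (b \<cdot>\<^sub>m M) = (a * b) \<cdot>\<^sub>m M"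
  for a :: "'a :: semigroup_mult"
  by (rule eq_matI) (auto simp: mult.assoc)

lemma one_smult_mat: "1 \<cdot>\<^sub>m M = M" for M :: "'a :: monoid_mult mat"
  by (rule eq_matI) auto

lemma mat_adjoint_mult:
  fixes A B :: "complex mat"
  assumes "A \<in> carrier_mat n m" and "B \<in> carrier_mat m k"
  shows "mat_adjoint (A * B) = mat_adjoint B * mat_adjoint A"
proof -
  interpret semiring_hom cnj by unfold_locales auto
  show ?thesis using assms
    unfolding mat_adjoint_altdef transpose_mult[OF assms]
    by (intro mat_hom_mult) auto
qed

lemma mat_adjoint_four_block:
  fixes A B C D :: "complex mat"
  assumes "A \<in> carrier_mat n1 m1" "B \<in> carrier_mat n1 m2"
    and "C \<in> carrier_mat n2 m1" "D \<in> carrier_mat n2 m2"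
  shows "mat_adjoint (four_block_mat A B C D) =
    four_block_mat (mat_adjoint A) (mat_adjoint C) (mat_adjoint B) (mat_adjoint D)"
  unfolding mat_adjoint_altdef transpose_four_block_mat[OF assms]
  by (rule map_four_block_mat) (use assms in auto)

lemma four_block_mat_inject:
  assumes "A \<in> carrier_mat n1 m1" "B \<in> carrier_mat n1 m2"
    and "C \<in> carrier_mat n2 m1" "D \<in> carrier_mat n2 m2"
    and "A' \<in> carrier_mat n1 m1" "B' \<in> carrier_mat n1 m2"
    and "C' \<in> carrier_mat n2 m1" "D' \<in> carrier_mat n2 m2"
    and eq: "four_block_mat A B C D = four_block_mat A' B' C' D'"
  shows "A = A'" "B = B'" "C = C'" "D = D'"
proof -
  have *: "four_block_mat A B C D $$ (i, j) = four_block_mat A' B' C' D' $$ (i, j)" for i j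
    using eq by simp
  show "A = A'"
  proof (rule eq_matI)
    fix i j assume "i < dim_row A'" "j < dim_col A'"
    then show "A $$ (i, j) = A' $$ (i, j)" using *[of i j] assms(1-8) by auto
  qed (use assms in auto)
  show "B = B'"
  proof (rule eq_matI)
    fix i j assume "i < dim_row B'" "j < dim_col B'"
    then show "B $$ (i, j) = B' $$ (i, j)" using *[of i "m1 + j"] assms(1-8) by auto
  qed (use assms in auto)
  show "C = C'"
  proof (rule eq_matI)
    fix i j assume "i < dim_row C'" "j < dim_col C'"
    then show "C $$ (i, j) = C' $$ (i, j)" using *[of "n1 + i" j] assms(1-8) by auto
  qed (use assms in auto)
  show "D = D'"
  proof (rule eq_matI)
    fix i j assume "i < dim_row D'" "j < dim_col D'"
    then show "D $$ (i, j) = D' $$ (i, j)" using *[of "n1 + i" "m1 + j"] assms(1-8) by auto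
  qed (use assms in auto)
qed

text \<open>
  Stacking the rows of \<open>M\<close> and \<open>K\<close> is a four-block matrix whose right blocks have no columns; padding
  \<open>G\<close> with empty blocks in the same way reduces the claim to products of four-block matrices.
\<close>
lemma append_rows_congruence:
  fixes M K G :: "complex mat"
  assumes M: "M \<in> carrier_mat n m" and K: "K \<in> carrier_mat k m" and G: "G \<in> carrier_mat m m"
  shows "(M @\<^sub>r K) * G * mat_adjoint (M @\<^sub>r K) =
    four_block_mat (M * G * mat_adjoint M) (M * G * mat_adjoint K)
      (K * G * mat_adjoint M) (K * G * mat_adjoint K)"
proof -
  have "(M @\<^sub>r K) * four_block_mat G (0\<^sub>m m 0) (0\<^sub>m 0 m) (0\<^sub>m 0 0) = 
    four_block_mat (M * G) (0\<^sub>m n 0) (K * G) (0\<^sub>m k 0)"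
    unfolding append_rows_def
    by (subst mult_four_block_mat[of _ n m _ 0 _ k _ _ m _ 0]) (use assms in auto)
  moreover have "four_block_mat G (0\<^sub>m m 0) (0\<^sub>m 0 m) (0\<^sub>m 0 0) = G"
    using G by (intro eq_matI) auto
  moreover have "mat_adjoint (M @\<^sub>r K) =
    four_block_mat (mat_adjoint M) (mat_adjoint K) (0\<^sub>m 0 n) (0\<^sub>m 0 k)"
    unfolding append_rows_def
    by (subst mat_adjoint_four_block[of _ n m _ 0 _ k]) (use assms in auto)
  ultimately show ?thesis
    by (simp, subst mult_four_block_mat[of _ n m _ 0 _ k _ _ n _ k]) (use assms in auto)
qed

lemma append_rows_mult:
  fixes M K G :: "complex mat"
  assumes M: "M \<in> carrier_mat n m" and K: "K \<in> carrier_mat k m" and G: "G \<in> carrier_mat m p"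
  shows "(M @\<^sub>r K) * G = M * G @\<^sub>r K * G"
proof -
  have "(M @\<^sub>r K) * four_block_mat G (0\<^sub>m m 0) (0\<^sub>m 0 p) (0\<^sub>m 0 0) = 
    four_block_mat (M * G) (0\<^sub>m n 0) (K * G) (0\<^sub>m k 0)"
    unfolding append_rows_def
    by (subst mult_four_block_mat[of _ n m _ 0 _ k _ _ p _ 0]) (use assms in auto)
  moreover have "four_block_mat G (0\<^sub>m m 0) (0\<^sub>m 0 p) (0\<^sub>m 0 0) = G"
    using G by (intro eq_matI) auto
  ultimately show ?thesis
    using assms by (simp add: append_rows_def)
qed

lemma block_diagonal_congruence:
  fixes B D G1 G2 G3 G4 :: "complex mat"
  assumes "B \<in> carrier_mat m m" "D \<in> carrier_mat k k"
    and "G1 \<in> carrier_mat m m" "G2 \<in> carrier_mat m k"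
    and "G3 \<in> carrier_mat k m" "G4 \<in> carrier_mat k k"
  shows "four_block_mat B (0\<^sub>m m k) (0\<^sub>m k m) D * four_block_mat G1 G2 G3 G4 *
      mat_adjoint (four_block_mat B (0\<^sub>m m k) (0\<^sub>m k m) D) =
    four_block_mat (B * G1 * mat_adjoint B) (B * G2 * mat_adjoint D)
      (D * G3 * mat_adjoint B) (D * G4 * mat_adjoint D)"
proof -
  have "four_block_mat B (0\<^sub>m m k) (0\<^sub>m k m) D * four_block_mat G1 G2 G3 G4 =
    four_block_mat (B * G1) (B * G2) (D * G3) (D * G4)"
    by (subst mult_four_block_mat[of _ m m _ k _ k _ _ m _ k]) (use assms in auto)
  moreover have "mat_adjoint (four_block_mat B (0\<^sub>m m k) (0\<^sub>m k m) D) =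
    four_block_mat (mat_adjoint B) (0\<^sub>m m k) (0\<^sub>m k m) (mat_adjoint D)"
    by (subst mat_adjoint_four_block[of _ m m _ k _ k]) (use assms in auto)
  ultimately show ?thesis
    by (simp, subst mult_four_block_mat[of _ m m _ k _ k _ _ m _ k]) (use assms in auto)
qed

lemma mat_inverse_eqI:
  fixes B C :: "complex mat"
  assumes B: "B \<in> carrier_mat n n" and C: "C \<in> carrier_mat n n" and BC: "B * C = 1\<^sub>m n"
  shows "mat_inverse B = Some C"
proof -
  have CB: "C * B = 1\<^sub>m n" by (rule mat_mult_left_right_inverse[OF B C BC])
  have "B \<in> Units (ring_mat TYPE(complex) n ())"
    unfolding Units_def ring_mat_def using assms CB by auto
  then obtain C' where C': "mat_inverse B = Some C'"
    using mat_inverse(1)[OF B, of "()"] by auto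
  from mat_inverse(2)[OF B this] have c': "B * C' = 1\<^sub>m n" "C' \<in> carrier_mat n n" by auto
  have "C' = (C * B) * C'" using CB c' by simp
  also have "\<dots> = C * (B * C')" using assms c' by (intro assoc_mult_mat) auto
  also have "\<dots> = C" using c' C by simp
  finally show ?thesis using C' by simp
qed

lemma invertible_matE:
  fixes B :: "complex mat"
  assumes "invertible_mat B" and "B \<in> carrier_mat n n"
  obtains C where "C \<in> carrier_mat n n" "B * C = 1\<^sub>m n" "C * B = 1\<^sub>m n"
proof -
  from assms obtain C where *: "B * C = 1\<^sub>m n" "C * B = 1\<^sub>m (dim_row C)"
    unfolding invertible_mat_def inverts_mat_def by auto
  have "dim_col C = n" using arg_cong[OF *(1), of dim_col] by simp
  moreover have "dim_row C = n" using arg_cong[OF *(2), of dim_col] assms by simp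
  ultimately show ?thesis using that[of C] * by auto
qed

section \<open>The Stein equation\<close>

text \<open>
  Since \<open>B\<close> and \<open>D\<close> are upper triangular, entry \<open>(i, j)\<close> of \<open>B Z D\<^sup>H\<close> only involves entries of
  \<open>Z\<close> to the right of and below \<open>(i, j)\<close>. Working upwards from the lower right corner, these vanish
  except \<open>Z\<^sub>i\<^sub>j\<close> itself, and \<open>Z\<^sub>i\<^sub>j = b\<^sub>i\<^sub>i cnj d\<^sub>j\<^sub>j Z\<^sub>i\<^sub>j\<close> remains.
\<close>
lemma stein_upper_triangular_trivial:
  fixes B D Z :: "complex mat"
  assumes B: "B \<in> carrier_mat m m" "upper_triangular B"
    and D: "D \<in> carrier_mat k k" "upper_triangular D"
    and Z: "Z \<in> carrier_mat m k"
    and eq: "B * Z * mat_adjoint D = Z"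
    and ne: "\<And>a b. a \<in> set (diag_mat B) \<Longrightarrow> b \<in> set (diag_mat D) \<Longrightarrow> a * cnj b \<noteq> 1"
  shows "Z = 0\<^sub>m m k"
proof -
  have expand: "Z $$ (i, j) = (\<Sum>q<k. \<Sum>p<m. B $$ (i, p) * Z $$ (p, q) * cnj (D $$ (j, q)))"
    if "i < m" "j < k" for i j
  proof -
    have "Z $$ (i, j) = (B * Z * mat_adjoint D) $$ (i, j)" using eq by simp
    also have "\<dots> = (\<Sum>q<k. (\<Sum>p<m. B $$ (i, p) * Z $$ (p, q)) * cnj (D $$ (j, q)))"
      using that B D Z by (simp add: scalar_prod_def atLeast0LessThan)
    finally show ?thesis by (simp add: sum_distrib_right)
  qed
  have "i < m \<longrightarrow> j < k \<longrightarrow> Z $$ (i, j) = 0" for i j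
  proof (induction "m + k - (i + j)" arbitrary: i j rule: less_induct)
    case less
    show ?case
    proof (intro impI)
      assume ij: "i < m" "j < k"
      have 0: "B $$ (i, p) * Z $$ (p, q) * cnj (D $$ (j, q)) = 0"
        if "p < m" "q < k" "(p, q) \<noteq> (i, j)" for p q
      proof -
        consider "p < i" | "q < j" | "i \<le> p" "j \<le> q" by linarith
        then show ?thesis
        proof cases
          case 3
          then have "m + k - (p + q) < m + k - (i + j)" using that ij by auto
          then show ?thesis using less[of p q] that by simp
        qed (use B D ij upper_triangularD in auto)
      qed
      have "Z $$ (i, j) = (\<Sum>(q, p)\<in>{..<k} \<times> {..<m}. B $$ (i, p) * Z $$ (p, q) * cnj (D $$ (j, q)))"
        unfolding expand[OF ij] by (simp add: sum.cartesian_product)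
      also have "\<dots> = (\<Sum>(q, p)\<in>{(j, i)}. B $$ (i, p) * Z $$ (p, q) * cnj (D $$ (j, q)))"
      proof (rule sum.mono_neutral_right)
        show "\<forall>x\<in>{..<k} \<times> {..<m} - {(j, i)}.
          (case x of (q, p) \<Rightarrow> B $$ (i, p) * Z $$ (p, q) * cnj (D $$ (j, q))) = 0"
          using 0 by fastforce
      qed (use ij in auto)
      finally have "Z $$ (i, j) * (1 - B $$ (i, i) * cnj (D $$ (j, j))) = 0"
        by (simp add: algebra_simps)
      moreover have "B $$ (i, i) * cnj (D $$ (j, j)) \<noteq> 1"
        by (rule ne) (use ij B D in \<open>auto simp: diag_mat_def\<close>)
      ultimately show "Z $$ (i, j) = 0" by simp
    qed
  qed
  then show ?thesis using Z by (intro eq_matI) auto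
qed

lemma upper_triangular_diag_block_mat:
  assumes "\<And>B. B \<in> set Bs \<Longrightarrow> square_mat B \<and> upper_triangular B"
  shows "upper_triangular (diag_block_mat Bs)"
  by (rule upper_triangularI, rule diag_block_upper_triangular)
    (use assms in \<open>auto dest: upper_triangularD\<close>)

lemma diag_mat_diag_block_mat:
  "(\<And>B. B \<in> set Bs \<Longrightarrow> square_mat B) \<Longrightarrow>
    diag_mat (diag_block_mat Bs) = concat (map diag_mat Bs)"
proof (induction Bs)
  case Nil
  then show ?case by (simp add: diag_mat_def)
next
  case (Cons B Bs)
  have "square_mat (diag_block_mat Bs)" using Cons.prems by (intro diag_block_mat_square) auto
  then have "diag_mat (diag_block_mat (B # Bs)) = diag_mat B @ diag_mat (diag_block_mat Bs)"
    using Cons.prems unfolding diag_block_mat.simps Let_def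
    by (intro diag_four_block_mat[of _ "dim_row B" _ "dim_row (diag_block_mat Bs)"]) auto
  then show ?case using Cons by simp
qed

text \<open>
  Off-diagonal blocks of \<open>G\<close> solve a Stein equation between two blocks of \<open>J\<close>, hence vanish. The
  diagonal blocks inherit both the Stein equation and the (skew-)symmetry of \<open>G\<close>; splitting off one
  block at a time carries both along.
\<close>
lemma stein_solution_block_diagonal:
  fixes G :: "complex mat" and Jb :: "'i \<Rightarrow> complex mat"
  assumes "distinct js"
    and "\<And>j. j \<in> set js \<Longrightarrow> Jb j \<in> carrier_mat (d j) (d j) \<and> upper_triangular (Jb j)"
    and "\<And>i j a b. i \<in> set js \<Longrightarrow> j \<in> set js \<Longrightarrow> i \<noteq> j \<Longrightarrow>
      a \<in> set (diag_mat (Jb i)) \<Longrightarrow> b \<in> set (diag_mat (Jb j)) \<Longrightarrow> a * cnj b \<noteq> 1"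
    and "G \<in> carrier_mat (sum_list (map d js)) (sum_list (map d js))"
    and "diag_block_mat (map Jb js) * G * mat_adjoint (diag_block_mat (map Jb js)) = G"
    and "mat_adjoint G = c \<cdot>\<^sub>m G"
  shows "\<exists>Gb. G = diag_block_mat (map Gb js) \<and>
    (\<forall>j\<in>set js. Gb j \<in> carrier_mat (d j) (d j) \<and> Jb j * Gb j * mat_adjoint (Jb j) = Gb j \<and>
      mat_adjoint (Gb j) = c \<cdot>\<^sub>m Gb j)"
  using assms
proof (induction js arbitrary: G)
  case Nil
  then show ?case by auto
next
  case (Cons j js)
  define m where "m = d j"
  define k where "k = sum_list (map d js)"
  define B where "B = Jb j"
  define D where "D = diag_block_mat (map Jb js)"
  have B: "B \<in> carrier_mat m m" "upper_triangular B"
    using Cons.prems(2)[of j] by (auto simp: B_def m_def)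
  have sq: "\<And>M. M \<in> set (map Jb js) \<Longrightarrow> square_mat M \<and> upper_triangular M"
    using Cons.prems(2) by fastforce
  have dims: "map (dim_row \<circ> Jb) js = map d js" "map (dim_col \<circ> Jb) js = map d js"
    using Cons.prems(2) by fastforce+
  have Dc: "D \<in> carrier_mat k k"
    by (rule carrier_matI) (simp_all add: D_def k_def dim_diag_block_mat dims)
  have Du: "upper_triangular D"
    unfolding D_def using sq by (rule upper_triangular_diag_block_mat)
  have Dd: "set (diag_mat D) = (\<Union>i\<in>set js. set (diag_mat (Jb i)))"
    unfolding D_def using sq by (subst diag_mat_diag_block_mat) auto
  have J: "diag_block_mat (map Jb (j # js)) = four_block_mat B (0\<^sub>m m k) (0\<^sub>m k m) D"
    using B Dc by (simp add: Let_def B_def[symmetric] D_def[symmetric])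
  have G: "G \<in> carrier_mat (m + k) (m + k)" using Cons.prems(4) by (simp add: m_def k_def)
  obtain G1 G2 G3 G4 where "split_block G m m = (G1, G2, G3, G4)"
    by (cases "split_block G m m") auto
  from split_block[OF this, of k k] G
  have Gs: "G1 \<in> carrier_mat m m" "G2 \<in> carrier_mat m k" "G3 \<in> carrier_mat k m"
    "G4 \<in> carrier_mat k k" and G_eq: "G = four_block_mat G1 G2 G3 G4" by auto
  have "four_block_mat (B * G1 * mat_adjoint B) (B * G2 * mat_adjoint D)
      (D * G3 * mat_adjoint B) (D * G4 * mat_adjoint D) = four_block_mat G1 G2 G3 G4"
    using Cons.prems(5) unfolding J G_eq
    by (subst (asm) block_diagonal_congruence) (use B Dc Gs in auto)
  note * = four_block_mat_inject[OF _ _ _ _ Gs this]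
  have st: "B * G1 * mat_adjoint B = G1" "B * G2 * mat_adjoint D = G2"
    "D * G3 * mat_adjoint B = G3" "D * G4 * mat_adjoint D = G4"
    using B Dc Gs by (auto intro!: * mult_carrier_mat)
  have jn: "j \<notin> set js" using Cons.prems(1) by simp
  have "G2 = 0\<^sub>m m k"
  proof (rule stein_upper_triangular_trivial[OF B Dc Du Gs(2) st(2)])
    fix a b assume "a \<in> set (diag_mat B)" "b \<in> set (diag_mat D)"
    then obtain i where "i \<in> set js" "b \<in> set (diag_mat (Jb i))" unfolding Dd by auto
    then show "a * cnj b \<noteq> 1"
      using \<open>a \<in> set (diag_mat B)\<close> jn Cons.prems(3)[of j i a b] by (auto simp: B_def)
  qed
  moreover have "G3 = 0\<^sub>m k m"
  proof (rule stein_upper_triangular_trivial[OF Dc Du B Gs(3) st(3)])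
    fix a b assume "a \<in> set (diag_mat D)" "b \<in> set (diag_mat B)"
    then obtain i where "i \<in> set js" "a \<in> set (diag_mat (Jb i))" unfolding Dd by auto
    then show "a * cnj b \<noteq> 1"
      using \<open>b \<in> set (diag_mat B)\<close> jn Cons.prems(3)[of i j a b] by (auto simp: B_def)
  qed
  ultimately have G_diag: "G = four_block_mat G1 (0\<^sub>m m k) (0\<^sub>m k m) G4" using G_eq by simp
  have "four_block_mat (mat_adjoint G1) (0\<^sub>m m k) (0\<^sub>m k m) (mat_adjoint G4) =
    four_block_mat (c \<cdot>\<^sub>m G1) (c \<cdot>\<^sub>m 0\<^sub>m m k) (c \<cdot>\<^sub>m 0\<^sub>m k m) (c \<cdot>\<^sub>m G4)"
    using Cons.prems(6) Gs unfolding G_diag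
    by (simp add: mat_adjoint_four_block[of _ m m _ k _ k]
        smult_four_block_mat[of _ m m _ k _ k])
  note * = four_block_mat_inject[OF _ _ _ _ _ _ _ _ this, of m m k k]
  have adj: "mat_adjoint G1 = c \<cdot>\<^sub>m G1" "mat_adjoint G4 = c \<cdot>\<^sub>m G4"
    using Gs by (auto intro!: *(1) *(4))
  have "\<exists>Gb. G4 = diag_block_mat (map Gb js) \<and>
    (\<forall>j\<in>set js. Gb j \<in> carrier_mat (d j) (d j) \<and> Jb j * Gb j * mat_adjoint (Jb j) = Gb j \<and>
      mat_adjoint (Gb j) = c \<cdot>\<^sub>m Gb j)"
  proof (rule Cons.IH)
    show "a * cnj b \<noteq> 1" if "i \<in> set js" "i' \<in> set js" "i \<noteq> i'"
      "a \<in> set (diag_mat (Jb i))" "b \<in> set (diag_mat (Jb i'))" for i i' a b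
      using Cons.prems(3)[of i i' a b] that by simp
  qed (use Cons.prems(1,2) Gs st adj in \<open>auto simp: k_def D_def\<close>)
  then obtain Gb where Gb: "G4 = diag_block_mat (map Gb js)"
    "\<forall>j\<in>set js. Gb j \<in> carrier_mat (d j) (d j) \<and> Jb j * Gb j * mat_adjoint (Jb j) = Gb j \<and>
      mat_adjoint (Gb j) = c \<cdot>\<^sub>m Gb j" by blast
  have "map (Gb(j := G1)) (j # js) = G1 # map Gb js" using jn by auto
  then have "diag_block_mat (map (Gb(j := G1)) (j # js)) = diag_block_mat (G1 # map Gb js)"
    by (rule arg_cong)
  also have "\<dots> = G" using Gs by (simp add: Let_def G_diag Gb(1)[symmetric])
  finally have "G = diag_block_mat (map (Gb(j := G1)) (j # js))" ..
  moreover have "\<forall>i\<in>set (j # js). (Gb(j := G1)) i \<in> carrier_mat (d i) (d i) \<and>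
      Jb i * (Gb(j := G1)) i * mat_adjoint (Jb i) = (Gb(j := G1)) i \<and>
      mat_adjoint ((Gb(j := G1)) i) = c \<cdot>\<^sub>m (Gb(j := G1)) i"
    using Gb(2) jn Gs st adj by (auto simp: m_def B_def)
  ultimately show ?case by blast
qed


text \<open>
  The refinement for a block \<open>diag(B, D)\<close> such as \<open>diag(\<lambda> I + N, 1 / cnj \<lambda> I + N)\<close>, where products
  \<open>a cnj b = 1\<close> only arise between \<open>B\<close> and \<open>D\<close>: the diagonal blocks of \<open>G\<close> vanish, and the symmetry
  ties the lower off-diagonal block to the upper one.
\<close>
lemma stein_paired_block:
  fixes G :: "complex mat"
  assumes B: "B \<in> carrier_mat m m" "upper_triangular B"
    and D: "D \<in> carrier_mat m m" "upper_triangular D"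
    and BB: "\<And>a a'. a \<in> set (diag_mat B) \<Longrightarrow> a' \<in> set (diag_mat B) \<Longrightarrow> a * cnj a' \<noteq> 1"
    and DD: "\<And>a a'. a \<in> set (diag_mat D) \<Longrightarrow> a' \<in> set (diag_mat D) \<Longrightarrow> a * cnj a' \<noteq> 1"
    and G: "G \<in> carrier_mat (2 * m) (2 * m)"
    and eq: "diag_block_mat [B, D] * G * mat_adjoint (diag_block_mat [B, D]) = G"
    and adj: "mat_adjoint G = c \<cdot>\<^sub>m G" and c: "c * c = 1"
  shows "\<exists>S. S \<in> carrier_mat m m \<and> B * S * mat_adjoint D = S \<and>
    G = four_block_mat (0\<^sub>m m m) S (c \<cdot>\<^sub>m mat_adjoint S) (0\<^sub>m m m)"
proof -
  have J: "diag_block_mat [B, D] = four_block_mat B (0\<^sub>m m m) (0\<^sub>m m m) D"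
    using B D unfolding diag_block_mat.simps(2)[of B] diag_block_mat_singleton by (simp add: Let_def)
  obtain G1 G2 G3 G4 where "split_block G m m = (G1, G2, G3, G4)"
    by (cases "split_block G m m") auto
  from split_block[OF this, of m m] G
  have Gs: "G1 \<in> carrier_mat m m" "G2 \<in> carrier_mat m m" "G3 \<in> carrier_mat m m"
    "G4 \<in> carrier_mat m m" and G_eq: "G = four_block_mat G1 G2 G3 G4" by auto
  have "four_block_mat (B * G1 * mat_adjoint B) (B * G2 * mat_adjoint D)
      (D * G3 * mat_adjoint B) (D * G4 * mat_adjoint D) = four_block_mat G1 G2 G3 G4"
    using eq unfolding J G_eq
    by (subst (asm) block_diagonal_congruence) (use B D Gs in auto)
  note * = four_block_mat_inject[OF _ _ _ _ Gs this]
  have st: "B * G1 * mat_adjoint B = G1" "B * G2 * mat_adjoint D = G2"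
    "D * G4 * mat_adjoint D = G4"
    using B D Gs by (auto intro!: * mult_carrier_mat)
  have zero: "G1 = 0\<^sub>m m m" "G4 = 0\<^sub>m m m"
    using stein_upper_triangular_trivial[OF B B Gs(1) st(1) BB]
      stein_upper_triangular_trivial[OF D D Gs(4) st(3) DD] by auto
  have "four_block_mat (mat_adjoint G1) (mat_adjoint G3) (mat_adjoint G2) (mat_adjoint G4) =
    four_block_mat (c \<cdot>\<^sub>m G1) (c \<cdot>\<^sub>m G2) (c \<cdot>\<^sub>m G3) (c \<cdot>\<^sub>m G4)"
    using adj Gs unfolding G_eq
    by (simp add: mat_adjoint_four_block[of _ m m _ m _ m]
        smult_four_block_mat[of _ m m _ m _ m])
  note * = four_block_mat_inject(3)[OF _ _ _ _ _ _ _ _ this, of m m m m]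
  have "mat_adjoint G2 = c \<cdot>\<^sub>m G3" using Gs by (auto intro!: *)
  then have "c \<cdot>\<^sub>m mat_adjoint G2 = (c * c) \<cdot>\<^sub>m G3" by (simp add: smult_smult_mat)
  also have "\<dots> = G3" unfolding c by (intro eq_matI) auto
  finally show ?thesis using Gs st zero G_eq by (intro exI[of _ G2]) auto
qed

section \<open>Jordan blocks\<close>

text \<open>
  The entries of \<open>N\<close> are real, so \<open>(b I + N)\<^sup>H = cnj b I + N\<^sup>T\<close>; in the expanded product the term
  \<open>a cnj b Z\<close> cancels against the right-hand side. This covers the paired blocks with
  \<open>b = 1 / cnj a\<close> and the unimodular ones with \<open>b = a\<close>.
\<close>
lemma Theta_of_stein:
  assumes N: "superdiag_nilpotent m N" and Z: "Z \<in> carrier_mat m m"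
    and eq: "(a \<cdot>\<^sub>m 1\<^sub>m m + N) * Z * mat_adjoint (b \<cdot>\<^sub>m 1\<^sub>m m + N) = Z"
    and ab: "a * cnj b = 1"
  shows "Z \<in> Theta m N a (cnj b)"
proof -
  have Nc: "N \<in> carrier_mat m m" using N by (simp add: superdiag_nilpotent_def)
  have "cnj (N $$ (i, j)) = N $$ (i, j)" if "i < m" "j < m" for i j
  proof -
    have "N $$ (i, j) \<in> {0, 1}"
      using N that unfolding superdiag_nilpotent_def by (metis insert_iff)
    then show ?thesis by auto
  qed
  then have adj: "mat_adjoint (b \<cdot>\<^sub>m 1\<^sub>m m + N) = cnj b \<cdot>\<^sub>m 1\<^sub>m m + transpose_mat N"
    using Nc by (intro eq_matI) auto
  define T where "T = transpose_mat N"
  have T: "T \<in> carrier_mat m m" using Nc by (simp add: T_def)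
  have "(a \<cdot>\<^sub>m 1\<^sub>m m + N) * Z = a \<cdot>\<^sub>m Z + N * Z"
    using Nc Z by (subst add_mult_distrib_mat[of _ m m]) auto
  then have "Z = (a \<cdot>\<^sub>m Z + N * Z) * (cnj b \<cdot>\<^sub>m 1\<^sub>m m + T)"
    using eq adj by (simp add: T_def)
  also have "\<dots> = (a \<cdot>\<^sub>m Z + N * Z) * (cnj b \<cdot>\<^sub>m 1\<^sub>m m) + (a \<cdot>\<^sub>m Z + N * Z) * T"
    using Nc Z T by (intro mult_add_distrib_mat[of _ m m]) auto
  also have "(a \<cdot>\<^sub>m Z + N * Z) * (cnj b \<cdot>\<^sub>m 1\<^sub>m m) = cnj b \<cdot>\<^sub>m (a \<cdot>\<^sub>m Z + N * Z)"
    using Nc Z by (subst mult_smult_distrib[of _ m m]) auto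
  also have "(a \<cdot>\<^sub>m Z + N * Z) * T = a \<cdot>\<^sub>m (Z * T) + N * Z * T"
    using Nc Z T by (subst add_mult_distrib_mat[of _ m m]) auto
  finally have main: "Z = cnj b \<cdot>\<^sub>m (a \<cdot>\<^sub>m Z + N * Z) + (a \<cdot>\<^sub>m (Z * T) + N * Z * T)" .
  have "a \<cdot>\<^sub>m (Z * T) + cnj b \<cdot>\<^sub>m (N * Z) + N * Z * T = 0\<^sub>m m m"
  proof (rule eq_matI)
    fix i j assume ij: "i < dim_row (0\<^sub>m m m)" "j < dim_col (0\<^sub>m m m)"
    define NZ where "NZ = N * Z"
    define ZT where "ZT = Z * T"
    define NZT where "NZT = NZ * T"
    have c: "NZ \<in> carrier_mat m m" "ZT \<in> carrier_mat m m" "NZT \<in> carrier_mat m m"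
      using Nc Z T by (auto simp: NZ_def ZT_def NZT_def)
    have "Z $$ (i, j) = cnj b * (a * Z $$ (i, j) + NZ $$ (i, j)) + (a * ZT $$ (i, j) + NZT $$ (i, j))"
      using arg_cong[OF main, of "\<lambda>M. M $$ (i, j)"] ij c Z
      by (simp flip: NZ_def ZT_def NZT_def)
    also have "\<dots> = (a * cnj b) * Z $$ (i, j) + cnj b * NZ $$ (i, j) + (a * ZT $$ (i, j) + NZT $$ (i, j))"
      by (simp add: algebra_simps)
    finally have "a * ZT $$ (i, j) + cnj b * NZ $$ (i, j) + NZT $$ (i, j) = 0"
      unfolding ab by (simp add: algebra_simps)
    then show "(a \<cdot>\<^sub>m (Z * T) + cnj b \<cdot>\<^sub>m (N * Z) + N * Z * T) $$ (i, j) = 0\<^sub>m m m $$ (i, j)"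
      using ij c Z by (simp flip: NZ_def ZT_def NZT_def)
  qed (use Nc Z T in auto)
  then show ?thesis using Z by (simp add: Theta_def T_def)
qed

lemma eigenvalue_upper_triangular_iff:
  fixes B :: "complex mat"
  assumes "B \<in> carrier_mat m m" "upper_triangular B"
  shows "eigenvalue B k \<longleftrightarrow> k \<in> set (diag_mat B)"
  unfolding eigenvalue_root_char_poly[OF assms(1)] char_poly_upper_triangular[OF assms]
    poly_prod_list prod_list_zero_iff by auto

lemma shifted_nilpotent:
  assumes "superdiag_nilpotent m N" "0 < m"
  shows "a \<cdot>\<^sub>m 1\<^sub>m m + N \<in> carrier_mat m m" "upper_triangular (a \<cdot>\<^sub>m 1\<^sub>m m + N)"
    "set (diag_mat (a \<cdot>\<^sub>m 1\<^sub>m m + N)) = {a}"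
  using assms by (auto simp: superdiag_nilpotent_def diag_mat_def)

lemma J_block_spectrum:
  assumes N: "superdiag_nilpotent (ns j) (N j)" and pos: "0 < ns j"
  shows "J_block l ns lam N j \<in>
      carrier_mat (if j \<le> l then 2 * ns j else ns j) (if j \<le> l then 2 * ns j else ns j)"
    and "upper_triangular (J_block l ns lam N j)"
    and "set (diag_mat (J_block l ns lam N j)) = (if j \<le> l then {lam j, 1 / cnj (lam j)} else {lam j})"
proof -
  note sn = shifted_nilpotent[OF assms]
  have [simp]: "dim_row (N j) = ns j" "dim_col (N j) = ns j"
    using N by (auto simp: superdiag_nilpotent_def)
  show "J_block l ns lam N j \<in>
      carrier_mat (if j \<le> l then 2 * ns j else ns j) (if j \<le> l then 2 * ns j else ns j)"
    using N by (intro carrier_matI) (auto simp: J_block_def dim_diag_block_mat superdiag_nilpotent_def)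
  show "upper_triangular (J_block l ns lam N j)"
    using sn by (auto simp: J_block_def intro!: upper_triangular_diag_block_mat simp del: diag_block_mat.simps)
  show "set (diag_mat (J_block l ns lam N j)) = (if j \<le> l then {lam j, 1 / cnj (lam j)} else {lam j})"
  proof (cases "j \<le> l")
    case True
    have "diag_mat (J_block l ns lam N j) =
      concat (map diag_mat [lam j \<cdot>\<^sub>m 1\<^sub>m (ns j) + N j, (1 / cnj (lam j)) \<cdot>\<^sub>m 1\<^sub>m (ns j) + N j])"
      unfolding J_block_def if_P[OF True] by (rule diag_mat_diag_block_mat) auto
    then show ?thesis using True sn(3) by auto
  next
    case False
    then show ?thesis using sn(3) by (simp add: J_block_def)
  qed
qed

section \<open>The matrix \<Gamma> of a palindromic standard pair\<close>

text \<open>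
  All products that occur are values of the sesquilinear map \<open>b M K = M G K\<^sup>H\<close> at the three matrices
  \<open>X\<close>, \<open>Y = X J\<close> and \<open>Z = X J\<^sup>2\<close>. The choice \<open>U G U\<^sup>H = W\<close> prescribes \<open>b\<close> on \<open>X, Y\<close>; the
  defining equation \<open>A Z = - (Q Y + eps A\<^sup>H X)\<close> then determines \<open>b\<close> on \<open>Y, Z\<close>, and the two
  tables of values coincide.
\<close>
lemma standard_pair_Gamma:
  fixes eps :: complex
  assumes eps: "eps \<in> {1, -1}" and A: "A \<in> carrier_mat n n" and Q: "Q \<in> carrier_mat n n"
    and invA: "invertible_mat A" and Q_adj: "mat_adjoint Q = eps \<cdot>\<^sub>m Q"
    and sp: "standard_pair n eps A Q X J"
  shows "\<exists>G \<in> carrier_mat (2 * n) (2 * n). mat_adjoint G = (- eps) \<cdot>\<^sub>m G \<and>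
    J * G * mat_adjoint J = G \<and> G \<in> S_set (2 * n) J eps \<and>
    mat_inverse (X * J * G * mat_adjoint X) = Some A \<and>
    Q = - (A * X * (J ^\<^sub>m 2) * G * mat_adjoint X * A)"
proof -
  have ee: "eps * eps = 1" "cnj eps = eps" using eps by auto
  define m where "m = 2 * n"
  have X: "X \<in> carrier_mat n m" and J: "J \<in> carrier_mat m m"
    and invU: "invertible_mat (X @\<^sub>r (X * J))"
    and root: "A * X * (J ^\<^sub>m 2) + Q * X * J + eps \<cdot>\<^sub>m (mat_adjoint A * X) = 0\<^sub>m n m"
    using sp unfolding standard_pair_def m_def by auto
  obtain Ai where Ai: "Ai \<in> carrier_mat n n" "A * Ai = 1\<^sub>m n" "Ai * A = 1\<^sub>m n"
    using invertible_matE[OF invA A] by metis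
  define AH where "AH = mat_adjoint A"
  define AiH where "AiH = mat_adjoint Ai"
  have AH: "AH \<in> carrier_mat n n" and AiH: "AiH \<in> carrier_mat n n"
    using A Ai by (auto simp: AH_def AiH_def)
  have AH_inv: "AH * AiH = 1\<^sub>m n" "AiH * AH = 1\<^sub>m n"
    unfolding AH_def AiH_def mat_adjoint_mult[OF A Ai(1), symmetric]
      mat_adjoint_mult[OF Ai(1) A, symmetric] Ai by simp_all
  define Y where "Y = X * J"
  define Z where "Z = Y * J"
  have Y: "Y \<in> carrier_mat n m" and Z: "Z \<in> carrier_mat n m"
    using X J by (auto simp: Y_def Z_def)
  have J2: "J ^\<^sub>m 2 = J * J" using J by (simp add: numeral_2_eq_2)
  have XJ2: "X * J ^\<^sub>m 2 = Z" using X J by (simp add: J2 Z_def Y_def assoc_mult_mat[of _ n m _ m _ m])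
  define U where "U = X @\<^sub>r Y"
  have U: "U \<in> carrier_mat m m" using carrier_append_rows[OF X Y] by (simp add: U_def m_def mult_2)
  have UJ: "U * J = Y @\<^sub>r Z"
    unfolding U_def by (subst append_rows_mult[OF X Y J]) (simp add: Y_def Z_def)
  obtain V where V: "V \<in> carrier_mat m m" "U * V = 1\<^sub>m m" "V * U = 1\<^sub>m m"
    using invertible_matE[OF invU[folded Y_def U_def] U] by metis
  define UH where "UH = mat_adjoint U"
  define VH where "VH = mat_adjoint V"
  have UH: "UH \<in> carrier_mat m m" and VH: "VH \<in> carrier_mat m m"
    using U V by (auto simp: UH_def VH_def)
  have UH_inv: "UH * VH = 1\<^sub>m m" "VH * UH = 1\<^sub>m m"
    unfolding UH_def VH_def mat_adjoint_mult[OF U V(1), symmetric]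
      mat_adjoint_mult[OF V(1) U, symmetric] V by simp_all

  define W where "W = four_block_mat (0\<^sub>m n n) ((- eps) \<cdot>\<^sub>m AiH) Ai (0\<^sub>m n n)"
  define Wi where "Wi = four_block_mat (0\<^sub>m n n) A ((- eps) \<cdot>\<^sub>m AH) (0\<^sub>m n n)"
  have W: "W \<in> carrier_mat m m" and Wi: "Wi \<in> carrier_mat m m"
    using A AH Ai AiH by (auto simp: W_def Wi_def m_def mult_2)
  have W_adj: "mat_adjoint W = (- eps) \<cdot>\<^sub>m W"
  proof -
    have "mat_adjoint W = four_block_mat (0\<^sub>m n n) AiH ((- eps) \<cdot>\<^sub>m Ai) (0\<^sub>m n n)"
      unfolding W_def using Ai AiH
      by (subst mat_adjoint_four_block[of _ n n _ n _ n])
        (auto simp: mat_adjoint_smult ee AiH_def)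
    also have "\<dots> = (- eps) \<cdot>\<^sub>m W"
      unfolding W_def using Ai AiH
      by (subst smult_four_block_mat[of _ n n _ n _ n]) (auto simp: smult_smult_mat ee intro!: eq_matI)
    finally show ?thesis .
  qed
  have W_Wi: "W * Wi = 1\<^sub>m m"
  proof -
    have "((- eps) \<cdot>\<^sub>m AiH) * ((- eps) \<cdot>\<^sub>m AH) = 1\<^sub>m n"
    proof -
      have "((- eps) \<cdot>\<^sub>m AiH) * ((- eps) \<cdot>\<^sub>m AH) = ((- eps) * (- eps)) \<cdot>\<^sub>m (AiH * AH)"
        using AiH AH
        by (simp add: mult_smult_assoc_mat[of _ n n _ n] mult_smult_distrib[of _ n n _ n] smult_smult_mat)
      then show ?thesis by (auto simp: ee AH_inv intro!: eq_matI)
    qed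
    then have "W * Wi = four_block_mat (1\<^sub>m n) (0\<^sub>m n n) (0\<^sub>m n n) (1\<^sub>m n)"
      unfolding W_def Wi_def using A AH Ai AiH
      by (subst mult_four_block_mat[of _ n n _ n _ n _ _ n _ n]) auto
    then show ?thesis by (simp add: m_def mult_2)
  qed

  define G where "G = V * W * VH"
  have G: "G \<in> carrier_mat m m" using V W VH by (simp add: G_def)
  have G_adj: "mat_adjoint G = (- eps) \<cdot>\<^sub>m G"
    using V W VH unfolding G_def VH_def
    by (simp add: mat_adjoint_mult[of _ m m _ m] W_adj mult_smult_assoc_mat[of _ m m _ m]
        mult_smult_distrib[of _ m m _ m] assoc_mult_mat[of _ m m _ m _ m])
  have cancel: "U * (V * M) = M" "V * (U * M) = M" "UH * (VH * M) = M" "VH * (UH * M) = M"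
    if "M \<in> carrier_mat m m" for M
    using U V UH VH that
    by (simp_all add: assoc_mult_mat[of _ m m _ m _ m, symmetric] UH_inv)
  have UGU: "U * G * UH = W"
    using U V UH VH W unfolding G_def
    by (simp add: assoc_mult_mat[of _ m m _ m _ m] cancel UH_inv)
  define b where "b M K = M * G * mat_adjoint K" for M K
  have b: "b M K \<in> carrier_mat n n" if "M \<in> carrier_mat n m" "K \<in> carrier_mat n m" for M K
    using that G by (auto simp: b_def)
  have b_adj: "mat_adjoint (b M K) = (- eps) \<cdot>\<^sub>m b K M"
    if "M \<in> carrier_mat n m" "K \<in> carrier_mat n m" for M K
  proof -
    have MH: "mat_adjoint M \<in> carrier_mat m n" and KH: "mat_adjoint K \<in> carrier_mat m n"
      using that by auto
    have "mat_adjoint (b M K) = K * mat_adjoint (M * G)"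
      unfolding b_def using mat_adjoint_mult[OF mult_carrier_mat[OF that(1) G] KH] by simp
    also have "mat_adjoint (M * G) = (- eps) \<cdot>\<^sub>m (G * mat_adjoint M)"
      unfolding mat_adjoint_mult[OF that(1) G] G_adj by (rule mult_smult_assoc_mat[OF G MH])
    also have "K * ((- eps) \<cdot>\<^sub>m (G * mat_adjoint M)) = (- eps) \<cdot>\<^sub>m (K * (G * mat_adjoint M))"
      by (rule mult_smult_distrib[OF that(2) mult_carrier_mat[OF G MH]])
    also have "K * (G * mat_adjoint M) = b K M"
      unfolding b_def by (rule assoc_mult_mat[OF that(2) G MH, symmetric])
    finally show ?thesis .
  qed
  have blocks: "four_block_mat (b X X) (b X Y) (b Y X) (b Y Y) =
    four_block_mat (0\<^sub>m n n) ((- eps) \<cdot>\<^sub>m AiH) Ai (0\<^sub>m n n)"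
    using trans[OF append_rows_congruence[OF X Y G, symmetric] UGU[unfolded U_def UH_def]]
    unfolding b_def W_def .
  note inject = four_block_mat_inject[OF b[OF X X] b[OF X Y] b[OF Y X] b[OF Y Y]
      zero_carrier_mat smult_carrier_mat[OF AiH] Ai(1) zero_carrier_mat blocks]
  note bXX = inject(1) and bXY = inject(2) and bYX = inject(3) and bYY = inject(4)
  have rec: "A * b Z K = - (Q * b Y K + eps \<cdot>\<^sub>m (AH * b X K))" if K: "K \<in> carrier_mat n m" for K
  proof -
    have "A * Z + Q * Y + eps \<cdot>\<^sub>m (AH * X) = 0\<^sub>m n m"
      using root A Q X J unfolding AH_def[symmetric] XJ2[symmetric] Y_def J2
      by (simp add: assoc_mult_mat[of _ n n _ m _ m])
    then have "(A * Z + Q * Y + eps \<cdot>\<^sub>m (AH * X)) * (G * mat_adjoint K) = 0\<^sub>m n n"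
      using G K by (simp add: left_mult_zero_mat[of _ m n])
    moreover have "(A * Z + Q * Y + eps \<cdot>\<^sub>m (AH * X)) * (G * mat_adjoint K) =
        A * b Z K + Q * b Y K + eps \<cdot>\<^sub>m (AH * b X K)"
      using A Q AH X Y Z G K unfolding b_def
      by (simp add: add_mult_distrib_mat[of _ n m _ _ n] mult_smult_assoc_mat[of _ n m _ n]
          assoc_mult_mat[of _ n n _ m _ n] assoc_mult_mat[of _ n m _ m _ n])
    ultimately have *: "A * b Z K + Q * b Y K + eps \<cdot>\<^sub>m (AH * b X K) = 0\<^sub>m n n" by simp
    have c: "A * b Z K \<in> carrier_mat n n" "Q * b Y K \<in> carrier_mat n n" "AH * b X K \<in> carrier_mat n n"
      using A Q AH b[OF X K] b[OF Y K] b[OF Z K] by auto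
    show ?thesis
    proof (rule eq_matI)
      fix i j assume ij: "i < dim_row (- (Q * b Y K + eps \<cdot>\<^sub>m (AH * b X K)))"
        "j < dim_col (- (Q * b Y K + eps \<cdot>\<^sub>m (AH * b X K)))"
      then have ij: "i < n" "j < n" using c by auto
      show "(A * b Z K) $$ (i, j) = (- (Q * b Y K + eps \<cdot>\<^sub>m (AH * b X K))) $$ (i, j)"
        using arg_cong[OF *, of "\<lambda>M. M $$ (i, j)"] ij c
        by (simp del: index_mult_mat minus_add_distrib add: eq_neg_iff_add_eq_0 add.assoc)
    qed (use A Q AH b[OF X K] b[OF Y K] b[OF Z K] in auto)
  qed
  have A_cancel: "Ai * (A * M) = M" if "M \<in> carrier_mat n n" for M
    using A Ai that by (simp add: assoc_mult_mat[of _ n n _ n _ n, symmetric])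
  have bZY: "b Z Y = Ai"
  proof -
    have "A * b Z Y = 1\<^sub>m n"
      unfolding rec[OF Y] bYY bXY using Q AH AiH
      by (auto simp: mult_smult_distrib[of _ n n _ n] AH_inv smult_smult_mat ee intro!: eq_matI)
    then show ?thesis using A_cancel[OF b[OF Z Y]] Ai by simp
  qed
  have bYZ: "b Y Z = (- eps) \<cdot>\<^sub>m AiH"
    using arg_cong[OF b_adj[OF Z Y], of "\<lambda>M. (- eps) \<cdot>\<^sub>m M"]
    by (auto simp: bZY smult_smult_mat ee AiH_def intro!: eq_matI)
  have bZX: "b Z X = - (Ai * Q * Ai)"
  proof -
    have "A * b Z X = - (Q * Ai)"
      unfolding rec[OF X] bYX bXX using Q AH Ai by (auto intro!: eq_matI)
    then have "b Z X = Ai * (- (Q * Ai))" using A_cancel[OF b[OF Z X]] by simp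
    then show ?thesis using Ai Q by (simp add: assoc_mult_mat[of _ n n _ n _ n])
  qed
  have bXZ: "b X Z = AiH * Q * AiH"
  proof -
    have "mat_adjoint (b Z X) = (- eps) \<cdot>\<^sub>m (AiH * Q * AiH)"
    proof -
      have "mat_adjoint (b Z X) = - mat_adjoint (Ai * Q * Ai)" unfolding bZX by (auto intro!: eq_matI)
      also have "mat_adjoint (Ai * Q * Ai) = eps \<cdot>\<^sub>m (AiH * Q * AiH)"
        using Ai Q AiH
        by (simp add: mat_adjoint_mult[of _ n n _ n] Q_adj AiH_def[symmetric]
            mult_smult_assoc_mat[of _ n n _ n] mult_smult_distrib[of _ n n _ n]
            assoc_mult_mat[of _ n n _ n _ n])
      finally show ?thesis by (auto intro!: eq_matI)
    qed
    with b_adj[OF Z X] have "(- eps) \<cdot>\<^sub>m b X Z = (- eps) \<cdot>\<^sub>m (AiH * Q * AiH)" by simp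
    from arg_cong[OF this, of "\<lambda>M. (- eps) \<cdot>\<^sub>m M"] show ?thesis
      by (simp only: smult_smult_mat minus_mult_minus ee one_smult_mat)
  qed
  \<comment> \<open>The symmetry of \<open>Q\<close>, which entered through \<open>b X Z\<close>, cancels \<open>Q (b Y Z)\<close> against
    \<open>eps A\<^sup>H (b X Z)\<close> here.\<close>
  have bZZ: "b Z Z = 0\<^sub>m n n"
  proof -
    have cancel_smult: "- ((- eps) \<cdot>\<^sub>m M + eps \<cdot>\<^sub>m M) = 0\<^sub>m n n" if "M \<in> carrier_mat n n" for M
      using that by (intro eq_matI) auto
    have QAiH: "Q * AiH \<in> carrier_mat n n" using Q AiH by simp
    have "AH * b X Z = AH * (AiH * (Q * AiH))"
      unfolding bXZ by (simp only: assoc_mult_mat[OF AiH Q AiH])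
    also have "\<dots> = AH * AiH * (Q * AiH)"
      by (rule assoc_mult_mat[OF AH AiH QAiH, symmetric])
    also have "\<dots> = Q * AiH" unfolding AH_inv by (rule left_mult_one_mat[OF QAiH])
    finally have "A * b Z Z = - ((- eps) \<cdot>\<^sub>m (Q * AiH) + eps \<cdot>\<^sub>m (Q * AiH))"
      unfolding rec[OF Z] bYZ mult_smult_distrib[OF Q AiH] by (rule arg_cong)
    also have "\<dots> = 0\<^sub>m n n"
      by (rule cancel_smult[OF QAiH])
    finally have "A * b Z Z = 0\<^sub>m n n" .
    then show ?thesis using A_cancel[OF b[OF Z Z]] Ai by simp
  qed
  have stein: "J * G * mat_adjoint J = G"
  proof -
    have "(U * J) * G * mat_adjoint (U * J) = W"
      using append_rows_congruence[OF Y Z G]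
      by (simp add: UJ b_def[symmetric] bYY bYZ bZY bZZ W_def)
    moreover have "U * (J * G * H) * UH = (U * J) * G * (H * UH)" if "H \<in> carrier_mat m m" for H
      using that U J G UH by (simp add: assoc_mult_mat[of _ m m _ m _ m])
    from this[OF mat_adjoint_carrier[OF J]]
    have "U * (J * G * mat_adjoint J) * UH = (U * J) * G * mat_adjoint (U * J)"
      unfolding mat_adjoint_mult[OF U J] UH_def .
    ultimately have "U * (J * G * mat_adjoint J) * UH = W" by simp
    then have "V * (U * (J * G * mat_adjoint J) * UH) * VH = G" by (simp add: G_def)
    moreover have "V * (U * M * UH) * VH = M" if "M \<in> carrier_mat m m" for M
      using that U V UH VH by (simp add: assoc_mult_mat[of _ m m _ m _ m] cancel UH_inv)
    moreover have "J * G * mat_adjoint J \<in> carrier_mat m m"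
      using mult_carrier_mat[OF mult_carrier_mat[OF J G] mat_adjoint_carrier[OF J]] .
    ultimately show ?thesis by metis
  qed
  \<comment> \<open>As \<open>W\<close> is nonsingular, so is \<open>G\<close>, and \<open>J G J\<^sup>H = G\<close> then exhibits \<open>G J\<^sup>H G\<^sup>-\<^sup>1\<close> as the
    inverse of \<open>J\<close>.\<close>
  define Gi where "Gi = UH * Wi * U"
  have Gi: "Gi \<in> carrier_mat m m" using UH Wi U by (simp add: Gi_def)
  have G_Gi: "G * Gi = 1\<^sub>m m"
  proof -
    have "W * (Wi * U) = U" using W Wi U by (simp add: assoc_mult_mat[of _ m m _ m _ m, symmetric] W_Wi)
    then show ?thesis
      using U V UH VH W Wi
      by (simp add: G_def Gi_def assoc_mult_mat[of _ m m _ m _ m] cancel)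
  qed
  define C where "C = G * mat_adjoint J * Gi"
  have C: "C \<in> carrier_mat m m" using G J Gi by (auto simp: C_def)
  have JC: "J * C = 1\<^sub>m m"
  proof -
    have "J * C = J * G * mat_adjoint J * Gi"
      using G J Gi by (simp add: C_def assoc_mult_mat[of _ m m _ m _ m])
    then show ?thesis using stein G_Gi by simp
  qed
  have CJ: "C * J = 1\<^sub>m m" by (rule mat_mult_left_right_inverse[OF J C JC])
  have "J * G = G * mat_adjoint C"
  proof -
    have "mat_adjoint J * mat_adjoint C = 1\<^sub>m m" using mat_adjoint_mult[OF C J] CJ by simp
    then have "J * G = J * G * (mat_adjoint J * mat_adjoint C)" using J G by simp
    also have "\<dots> = J * G * mat_adjoint J * mat_adjoint C"
      by (rule assoc_mult_mat[OF mult_carrier_mat[OF J G] mat_adjoint_carrier[OF J]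
            mat_adjoint_carrier[OF C], symmetric])
    finally show ?thesis using stein by simp
  qed
  then have "G \<in> S_set m J eps"
    using G G_adj mat_inverse_eqI[OF J C JC] by (auto simp: S_set_def)
  moreover have "mat_inverse (X * J * G * mat_adjoint X) = Some A"
    using mat_inverse_eqI[OF Ai(1) A Ai(3)] bYX by (simp add: b_def Y_def)
  moreover have "Q = - (A * X * (J ^\<^sub>m 2) * G * mat_adjoint X * A)"
  proof -
    have "A * X * (J ^\<^sub>m 2) = A * Z"
      unfolding XJ2[symmetric] by (rule assoc_mult_mat[OF A X pow_carrier_mat[OF J]])
    moreover have "A * Z * G = A * (Z * G)" by (rule assoc_mult_mat[OF A Z G])
    moreover have "A * (Z * G) * mat_adjoint X = A * b Z X"
      unfolding b_def
      by (rule assoc_mult_mat[OF A mult_carrier_mat[OF Z G] mat_adjoint_carrier[OF X]])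
    ultimately have "A * X * (J ^\<^sub>m 2) * G * mat_adjoint X = A * b Z X" by simp
    also have "\<dots> = - (Q * Ai)"
      unfolding rec[OF X] bYX bXX using Q AH Ai by (auto intro!: eq_matI)
    finally have "A * X * (J ^\<^sub>m 2) * G * mat_adjoint X * A = - (Q * Ai) * A" by simp
    also have "\<dots> = - Q" using Q Ai A by (simp add: assoc_mult_mat[of _ n n _ n _ n])
    finally show ?thesis by (auto intro!: eq_matI)
  qed
  ultimately show ?thesis using G G_adj stein by (auto simp: m_def)
qed

section \<open>The block structure of \<Gamma>\<close>

lemma mult_cnj_self_eq_1_iff: "z * cnj z = 1 \<longleftrightarrow> cmod z = 1"
  by (simp flip: complex_norm_square of_real_power add: power2_eq_1_iff) (use norm_ge_zero[of z] in linarith)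

theorem theorem3p5:
  fixes n l r :: nat and eps :: complex
    and A Q X J :: "complex mat"
    and ns :: "nat \<Rightarrow> nat" and lam :: "nat \<Rightarrow> complex"
    and N Xs :: "nat \<Rightarrow> complex mat"
  assumes "eps \<in> {1, -1}"
    and "A \<in> carrier_mat n n" and "Q \<in> carrier_mat n n"
    and "invertible_mat A"
    and "mat_adjoint Q = eps \<cdot>\<^sub>m Q"
    and "standard_pair n eps A Q X J"
    and "jordan_form n l r ns lam N J"
    and "conformable_partition n l r ns Xs X"
  shows "\<exists>G S. G \<in> S_set (2 * n) J eps \<and>
           mat_inverse (X * J * G * mat_adjoint X) = Some A \<and>
           Q = - (A * X * (J ^\<^sub>m 2) * G * mat_adjoint X * A) \<and>
           mat_adjoint Q = eps \<cdot>\<^sub>m Q \<and>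
           G = diag_block_mat (map (Gamma_block l ns eps S) [1..<Suc r]) \<and>
           (\<forall>j\<in>{1..l}. S j \<in> Theta (ns j) (N j) (lam j) (1 / lam j)) \<and>
           (\<forall>j\<in>{l+1..r}. S j \<in> Theta (ns j) (N j) (lam j) (cnj (lam j)) \<and>
              mat_adjoint (S j) = (- eps) \<cdot>\<^sub>m S j)"
proof -
  define js where "js = [1..<Suc r]"
  define Jb where "Jb = J_block l ns lam N"
  define d where "d j = (if j \<le> l then 2 * ns j else ns j)" for j
  note jf = assms(7)[unfolded jordan_form_def]
  have js: "distinct js" "set js = {1..r}" by (auto simp: js_def)
  have lr: "l \<le> r" using jf by blast
  have N: "superdiag_nilpotent (ns j) (N j)" and pos: "0 < ns j" if "j \<in> {1..r}" for j
    using jf that by blast+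
  have lam_paired: "lam j \<noteq> 0" "cmod (lam j) \<noteq> 1" if "j \<in> {1..l}" for j using jf that by blast+
  have lam_unit: "cmod (lam j) = 1" if "j \<in> {l+1..r}" for j using jf that by blast
  have J: "J = diag_block_mat (map Jb js)" using jf by (simp add: Jb_def js_def)
  have disj: "\<not> (eigenvalue (Jb i) k \<and> eigenvalue (Jb j) k)"
    if "i \<in> {1..r}" "j \<in> {1..r}" "i \<noteq> j" for i j k
    using jf that unfolding Jb_def by blast
  note block = J_block_spectrum[where ns = ns and N = N and l = l and lam = lam,
      OF N pos, folded Jb_def d_def]
  obtain G where G: "G \<in> carrier_mat (2 * n) (2 * n)" "mat_adjoint G = (- eps) \<cdot>\<^sub>m G"
    "J * G * mat_adjoint J = G" "G \<in> S_set (2 * n) J eps"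
    "mat_inverse (X * J * G * mat_adjoint X) = Some A"
    "Q = - (A * X * (J ^\<^sub>m 2) * G * mat_adjoint X * A)"
    using standard_pair_Gamma[OF assms(1-6)] by blast
  have "dim_row J = sum_list (map d js)"
  proof -
    have "map (dim_row \<circ> Jb) js = map d js"
      using block(1) js by (intro map_cong) auto
    then show ?thesis unfolding J by (simp only: dim_diag_block_mat map_map)
  qed
  then have dim: "sum_list (map d js) = 2 * n"
    using assms(6) by (auto simp: standard_pair_def)
  have "\<exists>Gb. G = diag_block_mat (map Gb js) \<and>
    (\<forall>j\<in>set js. Gb j \<in> carrier_mat (d j) (d j) \<and> Jb j * Gb j * mat_adjoint (Jb j) = Gb j \<and>
      mat_adjoint (Gb j) = (- eps) \<cdot>\<^sub>m Gb j)"
  proof (rule stein_solution_block_diagonal[OF js(1)])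
    fix i j a b assume ij: "i \<in> set js" "j \<in> set js" "i \<noteq> j"
      and a: "a \<in> set (diag_mat (Jb i))" and b: "b \<in> set (diag_mat (Jb j))"
    show "a * cnj b \<noteq> 1"
    proof
      assume ab: "a * cnj b = 1"
      then have "cnj b \<noteq> 0" by auto
      with ab have "a = 1 / cnj b" by (simp add: field_simps)
      also have "1 / cnj b \<in> set (diag_mat (Jb j))"
      proof (cases "j \<le> l")
        case True
        then show ?thesis using b block(3)[of j] ij js by auto
      next
        case False
        then have "b = lam j" "lam j * cnj (lam j) = 1"
          using b block(3)[of j] lam_unit[of j] ij js by (auto simp: mult_cnj_self_eq_1_iff)
        moreover from ab have "cnj b \<noteq> 0" by auto
        ultimately have "1 / cnj b = b" by (simp add: divide_eq_eq)
        then show ?thesis using b by simp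
      qed
      \<comment> \<open>The spectrum of block \<open>j\<close> is closed under \<open>z \<mapsto> 1 / cnj z\<close>, so \<open>a\<close> is a common
        eigenvalue.\<close>
      finally have "eigenvalue (Jb i) a" "eigenvalue (Jb j) a"
        using a eigenvalue_upper_triangular_iff[OF block(1,2)] ij js by auto
      then show False using disj[of i j a] ij js by simp
    qed
  qed (use block js G J dim in auto)
  then obtain Gb where Gb: "G = diag_block_mat (map Gb js)"
    "\<And>j. j \<in> {1..r} \<Longrightarrow> Gb j \<in> carrier_mat (d j) (d j)"
    "\<And>j. j \<in> {1..r} \<Longrightarrow> Jb j * Gb j * mat_adjoint (Jb j) = Gb j"
    "\<And>j. j \<in> {1..r} \<Longrightarrow> mat_adjoint (Gb j) = (- eps) \<cdot>\<^sub>m Gb j"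
    unfolding js by blast
  have "\<forall>j\<in>{1..l}. \<exists>S. S \<in> Theta (ns j) (N j) (lam j) (1 / lam j) \<and>
    Gb j = four_block_mat (0\<^sub>m (ns j) (ns j)) S ((- eps) \<cdot>\<^sub>m mat_adjoint S) (0\<^sub>m (ns j) (ns j))"
  proof
    fix j assume j: "j \<in> {1..l}"
    then have jr: "j \<in> {1..r}" and jl: "j \<le> l" using lr by auto
    let ?B = "lam j \<cdot>\<^sub>m 1\<^sub>m (ns j) + N j" and ?D = "(1 / cnj (lam j)) \<cdot>\<^sub>m 1\<^sub>m (ns j) + N j"
    note sn = shifted_nilpotent[OF N[OF jr] pos[OF jr]]
    have B: "lam j * cnj (lam j) \<noteq> 1"
      using lam_paired[OF j] by (simp add: mult_cnj_self_eq_1_iff)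
    then have D: "1 / cnj (lam j) * cnj (1 / cnj (lam j)) \<noteq> 1"
      using lam_paired[OF j] by (simp add: field_simps)
    have Jb_eq: "Jb j = diag_block_mat [?B, ?D]"
      using jl by (simp only: Jb_def J_block_def if_True)
    have "\<exists>S. S \<in> carrier_mat (ns j) (ns j) \<and> ?B * S * mat_adjoint ?D = S \<and>
      Gb j = four_block_mat (0\<^sub>m (ns j) (ns j)) S ((- eps) \<cdot>\<^sub>m mat_adjoint S) (0\<^sub>m (ns j) (ns j))"
    proof (rule stein_paired_block[OF sn(1,2) sn(1,2)])
      show "Gb j \<in> carrier_mat (2 * ns j) (2 * ns j)" using Gb(2)[OF jr] jl by (simp add: d_def)
      show "diag_block_mat [?B, ?D] * Gb j * mat_adjoint (diag_block_mat [?B, ?D]) = Gb j"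
        using Gb(3)[OF jr] unfolding Jb_eq .
      show "mat_adjoint (Gb j) = (- eps) \<cdot>\<^sub>m Gb j" by (rule Gb(4)[OF jr])
      show "- eps * - eps = 1" using assms(1) by auto
    qed (use B D sn(3) in auto)
    then obtain S where S: "S \<in> carrier_mat (ns j) (ns j)" "?B * S * mat_adjoint ?D = S"
      "Gb j = four_block_mat (0\<^sub>m (ns j) (ns j)) S ((- eps) \<cdot>\<^sub>m mat_adjoint S) (0\<^sub>m (ns j) (ns j))"
      by blast
    have "S \<in> Theta (ns j) (N j) (lam j) (cnj (1 / cnj (lam j)))"
      by (rule Theta_of_stein[OF N[OF jr] S(1,2)]) (use lam_paired[OF j] in simp)
    with S(3) show "\<exists>S. S \<in> Theta (ns j) (N j) (lam j) (1 / lam j) \<and>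
      Gb j = four_block_mat (0\<^sub>m (ns j) (ns j)) S ((- eps) \<cdot>\<^sub>m mat_adjoint S) (0\<^sub>m (ns j) (ns j))"
      by auto
  qed
  from bchoice[OF this] obtain S' where S':
    "\<And>j. j \<in> {1..l} \<Longrightarrow> S' j \<in> Theta (ns j) (N j) (lam j) (1 / lam j)"
    "\<And>j. j \<in> {1..l} \<Longrightarrow> Gb j = four_block_mat (0\<^sub>m (ns j) (ns j)) (S' j)
      ((- eps) \<cdot>\<^sub>m mat_adjoint (S' j)) (0\<^sub>m (ns j) (ns j))"
    by blast
  define S where "S j = (if j \<le> l then S' j else Gb j)" for j
  have "map Gb js = map (Gamma_block l ns eps S) js"
    using S'(2) js by (intro map_cong) (auto simp: Gamma_block_def S_def)
  with Gb(1) have "G = diag_block_mat (map (Gamma_block l ns eps S) js)" by simp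
  note this[unfolded js_def]
  moreover have "\<forall>j\<in>{1..l}. S j \<in> Theta (ns j) (N j) (lam j) (1 / lam j)"
    using S'(1) by (simp add: S_def)
  moreover have "\<forall>j\<in>{l+1..r}. S j \<in> Theta (ns j) (N j) (lam j) (cnj (lam j)) \<and>
    mat_adjoint (S j) = (- eps) \<cdot>\<^sub>m S j"
  proof
    fix j assume j: "j \<in> {l+1..r}"
    then have jr: "j \<in> {1..r}" and S: "S j = Gb j" by (auto simp: S_def)
    have Jb_eq: "Jb j = lam j \<cdot>\<^sub>m 1\<^sub>m (ns j) + N j" using j by (simp add: Jb_def J_block_def)
    have "Gb j \<in> carrier_mat (ns j) (ns j)" using Gb(2)[OF jr] j by (simp add: d_def)
    from Theta_of_stein[OF N[OF jr] this Gb(3)[OF jr, unfolded Jb_eq]]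
    have "Gb j \<in> Theta (ns j) (N j) (lam j) (cnj (lam j))"
      using lam_unit[OF j] by (simp add: mult_cnj_self_eq_1_iff)
    then show "S j \<in> Theta (ns j) (N j) (lam j) (cnj (lam j)) \<and> mat_adjoint (S j) = (- eps) \<cdot>\<^sub>m S j"
      using Gb(4)[OF jr] S by simp
  qed
  ultimately show ?thesis using G(4-6) assms(5) by blast
qed

end
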